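(* The following identity holds: $$\sum_{j=0}^\infty \frac{ q^{2j(j+1) } (q^3;q^6)_j }{ (q^2;q^2)_{2j}\, (q;q^2)_{j+1} } = \frac{ Q(q^{18},q)}{(q^2;q^2)_\infty}.$$
   Context: The identity is one of formal power series in $q$ (equivalently, of analytic functions of complex $q$ with $|q|<1$). Notation: $(a;q)_j := \prod_{k=0}^{j-1}(1-aq^k)$, with $(a;q)_0=1$; $(a;q)_\infty := \prod_{k=0}^\infty (1-aq^k)$; the base may be any power of $q$, e.g. $(q^3;q^6)_j=\prod_{k=0}^{j-1}(1-q^{3+6k})$. Also $(a_1,a_2,\dots,a_r;w)_\infty := \prod_{k=1}^r (a_k;w)_\infty$, and $$Q(w,x) := (-wx^{-1}, -x, w; w)_\infty\, (w x^{-2}, wx^2; w^2)_\infty.$$ *)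

theory Defs
  imports "HOL-Analysis.Analysis"
begin

definition qpoch :: "complex \<Rightarrow> complex \<Rightarrow> nat \<Rightarrow> complex" where
  "qpoch a q j = (\<Prod>k<j. 1 - a * q ^ k)"

(* The product converges for norm q < 1; a vanishing factor makes it 0, because
   prodinf is based on has_prod, which allows finitely many zero factors. *)
definition qpoch_inf :: "complex \<Rightarrow> complex \<Rightarrow> complex" where
  "qpoch_inf a q = (\<Prod>k. 1 - a * q ^ k)"

definition qpochs_inf :: "complex list \<Rightarrow> complex \<Rightarrow> complex" where
  "qpochs_inf as w = (\<Prod>a\<leftarrow>as. qpoch_inf a w)"

(* At x = 0 the convention inverse 0 = 0 applies. For w = q ^ 18 and x = q this agrees
   with the continuous extension to q = 0: the arguments w / x = q ^ 17 and
   w / x ^ 2 = q ^ 16 both vanish there. *)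
definition Q :: "complex \<Rightarrow> complex \<Rightarrow> complex" where
  "Q w x = qpochs_inf [- (w * inverse x), - x, w] w
         * qpochs_inf [w * inverse (x ^ 2), w * x ^ 2] (w ^ 2)"

end

theory Submission
  imports Defs
begin

text \<open>
  The summand is, up to the factor q^(2j(j+1)), the member \<beta>_j of a Bailey pair in base q^2. If
  \<omega> is a primitive cube root of unity, then 1 - u^3 = (1 - u) (1 - \<omega>u) (1 - u/\<omega>) yields
  (q^3; q^6)_j / (q; q^2)_j = (\<omega>q; q^2)_j (q/\<omega>; q^2)_j. For any z in place of \<omega>, the finite
  form of Jacobi's triple product expands this product, divided by (q^2; q^2)_{2j}.
  Summation by parts then absorbs the remaining factor 1 / (1 - q^(2j+1)), and the result
  (\<open>bailey_pair_two_parameter\<close>) is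
  \<beta>_j = \<Sum>s\<le>j. \<alpha>_s / ((q^2; q^2)_{j-s} (q^2; q^2)_{j+s+1}) with
  \<alpha>_s = (-1)^s q^(s^2) (1 + q^(2s+1)) c(s), where c(s) is the sum of z^r over \<bar>r\<bar> \<le> s.

  Summing \<beta>_j against q^(2j(j+1)) and interchanging the summations leaves, for each s, a Durfee
  rectangle sum, equal to q^(2s(s+1)) / (q^2; q^2)_\<infinity> (\<open>weak_bailey_lemma\<close>). So the series equals
  1 / (q^2; q^2)_\<infinity> times the sum of q^(2s(s+1)) \<alpha>_s. For z = \<omega> the numbers c(s) are
  1, 0, -1, periodically in s. What remains is the theta series that the quintuple
  product identity, with p = q^9 and x = q, evaluates as Q(q^18, q).

  The quintuple product identity (\<open>quintuple_product\<close>) is obtained by multiplying two triple products.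
  The triple product is the limit of its finite form, which thus serves twice.

  Theta series are written with integer exponents of q, which requires q \<noteq> 0; for q = 0 both
  sides of the final identity equal 1.
\<close>

section \<open>Shifted factorials and interchange of limits\<close>

lemma has_sum_dominated_convergence:
  fixes f :: "nat \<Rightarrow> 'a \<Rightarrow> 'b :: banach"
  assumes sums: "\<And>n. (f n has_sum S n) A"
    and bound: "\<And>n x. x \<in> A \<Longrightarrow> norm (f n x) \<le> g x"
    and g: "g summable_on A"
    and lim: "\<And>x. x \<in> A \<Longrightarrow> (\<lambda>n. f n x) \<longlonglongrightarrow> h x"
    and S: "S \<longlonglongrightarrow> L"
  shows "(h has_sum L) A"
proof -
  have unif: "uniform_limit UNIV (\<lambda>X n. \<Sum>x\<in>X. f n x) S (finite_subsets_at_top A)"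
    by (rule Weierstrass_m_test_general'[OF _ sums g]) (rule bound)
  have "norm (h x) \<le> g x" if "x \<in> A" for x
    by (rule Lim_norm_ubound[OF sequentially_bot lim[OF that]]) (simp add: bound[OF that])
  then have "h summable_on A"
    by (rule abs_summable_summable[OF Infinite_Sum.abs_summable_on_comparison_test'[OF g]])
  then have h: "(h has_sum infsum h A) A" by simp
  have "S \<longlonglongrightarrow> infsum h A"
  proof (rule swap_uniform_limit')
    show "\<forall>\<^sub>F X in finite_subsets_at_top A. (\<lambda>n. \<Sum>x\<in>X. f n x) \<longlonglongrightarrow> (\<Sum>x\<in>X. h x)"
      by (rule eventually_finite_subsets_at_top_weakI) (rule tendsto_sum, rule lim, blast)
    show "(sum h \<longlongrightarrow> infsum h A) (finite_subsets_at_top A)"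
      using h by (simp add: has_sum_def)
    show "uniform_limit UNIV (\<lambda>X n. \<Sum>x\<in>X. f n x) S (finite_subsets_at_top A)"
      by (rule unif)
  qed simp_all
  then have "L = infsum h A"
    using S LIMSEQ_unique by blast
  with h show ?thesis by simp
qed

lemma qpoch_Suc: "qpoch a q (Suc n) = qpoch a q n * (1 - a * q ^ n)"
  by (simp add: qpoch_def)

lemma one_minus_power_nonzero:
  fixes q :: complex
  assumes "norm q < 1" "n > 0"
  shows "1 - q ^ n \<noteq> 0"
proof
  assume "1 - q ^ n = 0"
  then have "norm q ^ n = 1" by (simp add: norm_power[symmetric])
  then show False using assms power_less_one_iff[of "norm q" n] by simp
qed

lemma qpoch_self_nonzero:
  assumes "norm q < 1"
  shows "qpoch q q n \<noteq> 0"
  using one_minus_power_nonzero[OF assms, of "Suc _"] by (auto simp: qpoch_def)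

lemma convergent_prod_qpoch:
  fixes a q :: complex
  assumes "norm q < 1"
  shows "convergent_prod (\<lambda>k. 1 - a * q ^ k)"
proof -
  have "summable (\<lambda>k. norm (- a * q ^ k))"
    using assms summable_mult[OF summable_geometric[of "norm q"], of "norm a"]
    by (simp add: norm_mult norm_power)
  then have "abs_convergent_prod (\<lambda>k. 1 + (- a * q ^ k))"
    by (intro summable_imp_abs_convergent_prod) simp
  then show ?thesis
    using abs_convergent_prod_imp_convergent_prod by fastforce
qed

lemma qpoch_tendsto:
  assumes "norm q < 1"
  shows "qpoch a q \<longlonglongrightarrow> qpoch_inf a q"
proof -
  have "(\<lambda>n. \<Prod>k\<le>n. 1 - a * q ^ k) \<longlonglongrightarrow> qpoch_inf a q"
    unfolding qpoch_inf_def by (rule convergent_prod_LIMSEQ[OF convergent_prod_qpoch[OF assms]])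
  then have "(\<lambda>n. qpoch a q (Suc n)) \<longlonglongrightarrow> qpoch_inf a q"
    by (simp add: qpoch_def lessThan_Suc_atMost)
  then show ?thesis by (rule LIMSEQ_imp_Suc)
qed

lemma qpoch_inf_self_nonzero:
  assumes "norm q < 1"
  shows "qpoch_inf q q \<noteq> 0"
  unfolding qpoch_inf_def
  using one_minus_power_nonzero[OF assms, of "Suc _"] convergent_prod_qpoch[OF assms]
  by (intro prodinf_nonzero) auto

text \<open>
  Letting 1 / (q; q)_i vanish for negative i makes the recurrence of the lemma
  \<open>inv_qfact_pred\<close> hold for every integer i, because its factor 1 - q^i is zero at i = 0.
  Sums that terminate for combinatorial reasons then become sums over all integers,
  which can be shifted without boundary terms.
\<close>

definition inv_qfact :: "complex \<Rightarrow> int \<Rightarrow> complex" where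
  "inv_qfact q i = (if i < 0 then 0 else 1 / qpoch q q (nat i))"

lemma inv_qfact_of_nat [simp]: "inv_qfact q (int n) = 1 / qpoch q q n"
  by (simp add: inv_qfact_def)

lemma inv_qfact_pred:
  assumes "norm q < 1"
  shows "inv_qfact q (i - 1) = (1 - q powi i) * inv_qfact q i"
proof (cases "i > 0")
  case True
  then obtain n where i: "i = int (Suc n)" by (metis gr0_conv_Suc zero_less_imp_eq_int)
  have "1 - q ^ Suc n \<noteq> 0"
    using one_minus_power_nonzero[OF assms] by blast
  then show ?thesis
    using qpoch_self_nonzero[OF assms, of n]
    by (simp add: i power_int_of_nat qpoch_Suc divide_simps del: of_nat_Suc) simp
next
  case False
  then show ?thesis by (cases "i = 0") (auto simp: inv_qfact_def)
qed

lemma inv_qfact_tendsto: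
  assumes "norm q < 1"
  shows "(\<lambda>n. inv_qfact q (int n)) \<longlonglongrightarrow> 1 / qpoch_inf q q"
  using tendsto_divide[OF tendsto_const qpoch_tendsto[OF assms] qpoch_inf_self_nonzero[OF assms]]
  by simp

lemma inv_qfact_tendsto_shift:
  assumes "norm q < 1"
  shows "(\<lambda>n. inv_qfact q (int n + r)) \<longlonglongrightarrow> 1 / qpoch_inf q q"
proof -
  have "(\<lambda>n. inv_qfact q (int (n + nat r) )) \<longlonglongrightarrow> 1 / qpoch_inf q q"
    by (rule LIMSEQ_ignore_initial_segment[OF inv_qfact_tendsto[OF assms]])
  then have "(\<lambda>n. inv_qfact q (int (n + nat (-r)) + r)) \<longlonglongrightarrow> 1 / qpoch_inf q q"
    by (cases "r \<ge> 0") (use inv_qfact_tendsto[OF assms] in auto)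
  then show ?thesis by (rule LIMSEQ_offset)
qed

lemma inv_qfact_bounded:
  assumes "norm q < 1"
  obtains C where "C \<ge> 0" "\<And>i. norm (inv_qfact q i) \<le> C"
proof -
  have "Bseq (\<lambda>n. inv_qfact q (int n))"
    using inv_qfact_tendsto[OF assms] convergent_def convergent_imp_Bseq by blast
  then obtain C where C: "C > 0" "\<And>n. norm (inv_qfact q (int n)) \<le> C"
    by (auto simp: Bseq_def)
  have "norm (inv_qfact q i) \<le> C" for i
    using C(1) C(2)[of "nat i"] by (cases "i < 0") (auto simp: inv_qfact_def)
  with C(1) show ?thesis using that[of C] by simp
qed

section \<open>The Jacobi triple product\<close>

text \<open>
  Passing from n to n + 1 multiplies the product side by (1 - z q^(2n+1)) (1 - q^(2n+1) / z),
  that is, it combines the series with its shifts by one to the left and to the right.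
  In terms of u = q^(2n+2-2r) and v = q^(2n+2+2r), the recurrence for the coefficients becomes
  a polynomial identity. With infinitely many r formally present, the two shifts
  leave the sum unchanged.
\<close>

lemma finite_jacobi_triple_product:
  assumes q: "norm q < 1" "q \<noteq> 0" and z: "z \<noteq> 0"
  shows "((\<lambda>r. (-z) powi r * q powi (r * r) *
             (inv_qfact (q^2) (int n - r) * inv_qfact (q^2) (int n + r)))
          has_sum (qpoch (z * q) (q^2) n * qpoch (q / z) (q^2) n / qpoch (q^2) (q^2) (2 * n))) UNIV"
proof (induction n)
  case 0
  show ?case
  proof (rule has_sum_finite_neutralI[of "{0}"])
    fix r :: int assume "r \<in> UNIV - {0}"
    then have "- r < 0 \<or> r < 0" by auto
    then show "(- z) powi r * q powi (r * r) *
         (inv_qfact (q\<^sup>2) (int 0 - r) * inv_qfact (q\<^sup>2) (int 0 + r)) = 0"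
      by (auto simp: inv_qfact_def)
  qed (auto simp: inv_qfact_def qpoch_def)
next
  case (Suc n)
  have q2: "norm (q^2) < 1"
    using q by (simp add: norm_power power_less_one_iff)
  define f where "f n r = (-z) powi r * q powi (r * r) *
             (inv_qfact (q^2) (int n - r) * inv_qfact (q^2) (int n + r))" for n :: nat and r
  define P where "P = qpoch (z * q) (q^2) n * qpoch (q / z) (q^2) n / qpoch (q^2) (q^2) (2 * n)"
  define A where "A = q ^ (2 * n + 2)"
  define D where "D = (1 - A\<^sup>2 / q\<^sup>2) * (1 - A\<^sup>2)"
  have A2: "A\<^sup>2 = q ^ (4 * n + 4)" "A\<^sup>2 / q\<^sup>2 = q ^ (4 * n + 2)" "A / q = q ^ (2 * n + 1)"
    using q by (auto simp: A_def power_mult[symmetric] power_add field_simps power2_eq_square eval_nat_numeral)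
  have D: "D \<noteq> 0"
    using one_minus_power_nonzero[OF q(1), of "4 * n + 2"]
      one_minus_power_nonzero[OF q(1), of "4 * n + 4"]
    unfolding D_def A2(2) by (simp add: A2(1))
  have f: "(f n has_sum P) UNIV"
    using Suc.IH by (simp add: f_def[abs_def] P_def)
  have shift: "((\<lambda>r. f n (r + c)) has_sum P) UNIV" for c
    by (subst has_sum_reindex_bij_witness[where i = "\<lambda>r. r - c" and j = "\<lambda>r. r + c" and T = UNIV])
       (use f in auto)
  have rec: "f (Suc n) r = ((1 + A\<^sup>2 / q\<^sup>2) * f n r - z * (A / q) * f n (r + (-1)) - A / q / z * f n (r + 1)) / D" for r
  proof -
    define W where "W = inv_qfact (q^2) (int n + 1 - r) * inv_qfact (q^2) (int n + 1 + r)"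
    define B where "B = q powi (2 * r)"
    define X where "X = (-z) powi r * q powi (r * r)"
    have B0: "B \<noteq> 0" using q by (simp add: B_def)
    have pw: "(q\<^sup>2) powi (int n + 1 - r) = A / B" "(q\<^sup>2) powi (int n + 1 + r) = A * B"
      "(q\<^sup>2) powi (int n - r) = A / B / q\<^sup>2" "(q\<^sup>2) powi (int n + r) = A * B / q\<^sup>2"
    proof -
      have "A = q powi (2 * int n + 2)"
        unfolding A_def by (metis of_nat_add of_nat_mult of_nat_numeral power_int_of_nat)
      moreover have "q\<^sup>2 = q powi 2" by simp
      ultimately show "(q\<^sup>2) powi (int n + 1 - r) = A / B" "(q\<^sup>2) powi (int n + 1 + r) = A * B"
        "(q\<^sup>2) powi (int n - r) = A / B / q\<^sup>2" "(q\<^sup>2) powi (int n + r) = A * B / q\<^sup>2"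
        unfolding B_def
        by (simp_all only: power_int_mult[symmetric] power_int_add[OF disjI1[OF q(2)], symmetric]
            power_int_diff[OF disjI1[OF q(2)], symmetric])
           (simp_all add: algebra_simps)
    qed
    have i1: "inv_qfact (q^2) (int n - r) = (1 - A / B) * inv_qfact (q^2) (int n + 1 - r)"
      using inv_qfact_pred[OF q2, of "int n + 1 - r"] by (simp add: pw)
    have i2: "inv_qfact (q^2) (int n + r) = (1 - A * B) * inv_qfact (q^2) (int n + 1 + r)"
      using inv_qfact_pred[OF q2, of "int n + 1 + r"] by (simp add: pw)
    have i3: "inv_qfact (q^2) (int n - r - 1) = (1 - A / B / q\<^sup>2) * ((1 - A / B) * inv_qfact (q^2) (int n + 1 - r))"
      using inv_qfact_pred[OF q2, of "int n - r"] by (simp add: pw i1)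
    have i4: "inv_qfact (q^2) (int n + r - 1) = (1 - A * B / q\<^sup>2) * ((1 - A * B) * inv_qfact (q^2) (int n + 1 + r))"
      using inv_qfact_pred[OF q2, of "int n + r"] by (simp add: pw i2)
    have f1: "f (Suc n) r = X * W"
      by (simp add: f_def X_def W_def algebra_simps)
    have f2: "f n r = X * ((1 - A / B) * (1 - A * B) * W)"
      by (simp add: f_def X_def W_def i1 i2)
    have f3: "f n (r + (-1)) = X * (-1 / z) * q / B * ((1 - A * B) * (1 - A * B / q\<^sup>2) * W)"
    proof -
      have "(-z) powi (r - 1) * q powi ((r - 1) * (r - 1)) = X * (-1 / z) * q / B"
      proof -
        have "(r - 1) * (r - 1) = r * r - 2 * r + 1" by (simp add: algebra_simps)
        then show ?thesis using q z
          by (simp add: X_def B_def power_int_add power_int_diff)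
      qed
      moreover have "f n (r + (-1)) = ((-z) powi (r - 1) * q powi ((r - 1) * (r - 1))) *
          (inv_qfact (q^2) (int n + 1 - r) * inv_qfact (q^2) (int n + r - 1))"
        by (simp add: f_def algebra_simps)
      ultimately show ?thesis by (simp add: W_def i4)
    qed
    have f4: "f n (r + 1) = X * (- z) * q * B * ((1 - A / B) * (1 - A / B / q\<^sup>2) * W)"
    proof -
      have "(-z) powi (r + 1) * q powi ((r + 1) * (r + 1)) = X * (- z) * q * B"
      proof -
        have "(r + 1) * (r + 1) = r * r + 2 * r + 1" by (simp add: algebra_simps)
        then show ?thesis using q z
          by (simp add: X_def B_def power_int_add power_int_diff)
      qed
      moreover have "f n (r + 1) = ((-z) powi (r + 1) * q powi ((r + 1) * (r + 1))) *
          (inv_qfact (q^2) (int n - r - 1) * inv_qfact (q^2) (int n + 1 + r))"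
        by (simp add: f_def algebra_simps)
      ultimately show ?thesis by (simp add: W_def i3)
    qed
    have "D * f (Suc n) r = (1 + A\<^sup>2 / q\<^sup>2) * f n r - z * (A / q) * f n (r + (-1)) - A / q / z * f n (r + 1)"
    proof -
      \<comment> \<open>The common factor X W is pulled out, and the rest is polynomial in u, v and p = 1 / q^2.\<close>
      define u v p where "u = A / B" and "v = A * B" and "p = 1 / q\<^sup>2"
      have poly: "(1 - u * v * p) * (1 - u * v) = (1 + u * v * p) * ((1 - u) * (1 - v))
          + u * ((1 - v) * (1 - v * p)) + v * ((1 - u) * (1 - u * p))"
        by (simp add: algebra_simps)
      have uv: "A\<^sup>2 = u * v" "x / q\<^sup>2 = x * p" for x
        using B0 by (simp_all add: u_def v_def p_def power2_eq_square)
      have c: "z * (A / q) * (X * (-1 / z) * q / B * Y) = - (X * u * Y)"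
        "A / q / z * (X * (- z) * q * B * Y) = - (X * v * Y)" for Y
        using q z by (simp_all add: u_def v_def)
      have "D * (X * W) = X * ((1 - u * v * p) * (1 - u * v) * W)"
        unfolding D_def uv by simp
      also have "\<dots> = X * (((1 + u * v * p) * ((1 - u) * (1 - v))
          + u * ((1 - v) * (1 - v * p)) + v * ((1 - u) * (1 - u * p))) * W)"
        unfolding poly ..
      also have "\<dots> = (1 + u * v * p) * (X * ((1 - u) * (1 - v) * W))
          - - (X * u * ((1 - v) * (1 - v * p) * W)) - - (X * v * ((1 - u) * (1 - u * p) * W))"
        by (simp only: distrib_left distrib_right minus_diff_eq diff_minus_eq_add mult_ac)
      finally show ?thesis
        unfolding f1 f2 f3 f4 c uv u_def[symmetric] v_def[symmetric] .
    qed
    then show ?thesis using nonzero_mult_div_cancel_left[OF D] by metis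
  qed
  have "((\<lambda>r. 1 / D * ((1 + A\<^sup>2 / q\<^sup>2) * f n r + (- (z * (A / q))) * f n (r + (-1)) + (- (A / q / z)) * f n (r + 1))) has_sum
      (1 / D * ((1 + A\<^sup>2 / q\<^sup>2) * P + (- (z * (A / q))) * P + (- (A / q / z)) * P))) UNIV"
    by (intro has_sum_cmult_right has_sum_add shift f)
  moreover have "(\<lambda>r. 1 / D * ((1 + A\<^sup>2 / q\<^sup>2) * f n r + (- (z * (A / q))) * f n (r + (-1)) + (- (A / q / z)) * f n (r + 1))) = f (Suc n)"
    by (rule ext) (simp only: rec, simp)
  moreover have "1 / D * ((1 + A\<^sup>2 / q\<^sup>2) * P + (- (z * (A / q))) * P + (- (A / q / z)) * P)
      = qpoch (z * q) (q^2) (Suc n) * qpoch (q / z) (q^2) (Suc n) / qpoch (q^2) (q^2) (2 * Suc n)"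
  proof -
    have "qpoch (q^2) (q^2) (2 * Suc n) = qpoch (q^2) (q^2) (2 * n) * D"
    proof -
      have "q^2 * (q^2) ^ (2 * n) = A\<^sup>2 / q\<^sup>2" "q^2 * (q^2) ^ (Suc (2 * n)) = A\<^sup>2"
        unfolding A2(2) unfolding A2(1) power_mult[symmetric] power_add[symmetric]
        by (rule arg_cong[where f = "power q"]; simp)+
      then show ?thesis by (simp only: mult_Suc_right qpoch_Suc D_def add_2_eq_Suc) (simp add: algebra_simps)
    qed
    moreover have "z * q * (q^2) ^ n = z * (A / q)" "q / z * (q^2) ^ n = A / q / z"
      unfolding A2(3) by (simp_all add: power_mult[symmetric])
    moreover have "(1 + A\<^sup>2 / q\<^sup>2) * P + (- (z * (A / q))) * P + (- (A / q / z)) * P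
       = P * ((1 - z * (A / q)) * (1 - A / q / z))"
    proof -
      have e: "A\<^sup>2 / q\<^sup>2 = (z * (A / q)) * (A / q / z)"
        using z by (simp add: power2_eq_square)
      have "(1 + s * t) * P + (- s) * P + (- t) * P = P * ((1 - s) * (1 - t))" for s t :: complex
        by (simp add: algebra_simps)
      from this[of "z * (A / q)" "A / q / z"] show ?thesis unfolding e .
    qed
    ultimately show ?thesis
      by (simp only: qpoch_Suc) (simp add: P_def mult_ac)
  qed
  ultimately show ?case by (simp add: f_def[abs_def])
qed

lemma summable_power_square:
  fixes c r :: real
  assumes "c \<ge> 0" "0 \<le> r" "r < 1"
  shows "summable (\<lambda>n. c ^ n * r ^ (n * n))"
proof -
  have "(\<lambda>n. c * r ^ n) \<longlonglongrightarrow> c * 0"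
    by (intro tendsto_mult tendsto_const LIMSEQ_realpow_zero assms)
  then have "\<forall>\<^sub>F n in sequentially. c * r ^ n < 1 / 2"
    by (rule order_tendstoD) simp
  then have "\<forall>\<^sub>F n in sequentially. norm (c ^ n * r ^ (n * n)) \<le> (1 / 2) ^ n"
  proof eventually_elim
    case (elim n)
    have "norm (c ^ n * r ^ (n * n)) = (c * r ^ n) ^ n"
      using assms by (simp add: power_mult_distrib power_mult)
    also have "\<dots> \<le> (1 / 2) ^ n"
      using elim assms by (intro power_mono) auto
    finally show ?case .
  qed
  then show ?thesis
    by (rule summable_comparison_test_ev) (simp add: summable_geometric)
qed

lemma abs_summable_theta:
  fixes q z :: complex
  assumes q: "norm q < 1" and z: "z \<noteq> 0"
  shows "(\<lambda>r::int. norm (z powi r * q powi (r * r))) summable_on UNIV"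
proof -
  let ?f = "\<lambda>r::int. norm (z powi r * q powi (r * r))"
  \<comment> \<open>The series over the integers is the union of two one-sided series, overlapping in r = 0.\<close>
  have half: "?f summable_on range (\<lambda>n. s * int n)" if s: "s = 1 \<or> s = -1" for s :: int
  proof -
    have "summable (\<lambda>n. norm (z powi s) ^ n * norm q ^ (n * n))"
      by (rule summable_power_square) (use q in auto)
    then have "(\<lambda>n. norm (z powi s) ^ n * norm q ^ (n * n)) summable_on UNIV"
      by (subst summable_on_UNIV_nonneg_real_iff) auto
    moreover have "norm (z powi s) ^ n * norm q ^ (n * n) = ?f (s * int n)" for n
    proof -
      have "(s * int n) * (s * int n) = int (n * n)" using s by auto
      then have "q powi (s * int n * (s * int n)) = q ^ (n * n)"
        by (metis power_int_of_nat)
      moreover have "z powi (s * int n) = (z powi s) ^ n"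
        by (simp add: power_int_mult)
      ultimately show ?thesis by (simp add: norm_mult norm_power)
    qed
    moreover have "inj (\<lambda>n. s * int n)" using s by (auto simp: inj_on_def)
    ultimately show ?thesis
      by (subst summable_on_reindex) (auto simp: o_def)
  qed
  have "(UNIV :: int set) = range (\<lambda>n. 1 * int n) \<union> range (\<lambda>n. -1 * int n)"
  proof -
    have "r \<in> range (\<lambda>n. 1 * int n) \<union> range (\<lambda>n. -1 * int n)" for r :: int
    proof (cases "r \<ge> 0")
      case True
      then have "r = 1 * int (nat r)" by simp
      then show ?thesis by blast
    next
      case False
      then have "r = -1 * int (nat (- r))" by simp
      then show ?thesis by blast
    qed
    then show ?thesis by blast
  qed
  moreover have "?f summable_on (range (\<lambda>n. 1 * int n) \<union> range (\<lambda>n. -1 * int n))"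
    by (rule summable_on_union) (rule half, simp)+
  ultimately show ?thesis by simp
qed

text \<open>
  The limit of the finite version: both inverse factorials in the coefficient tend to
  1 / (q^2; q^2)_\<infinity> for each fixed r and are bounded uniformly, so the theta series itself is,
  up to a constant, a summable majorant.
\<close>

theorem jacobi_triple_product:
  assumes q: "norm q < 1" "q \<noteq> 0" and z: "z \<noteq> 0"
  shows "((\<lambda>r. (-z) powi r * q powi (r * r)) has_sum
           (qpoch_inf (z * q) (q^2) * qpoch_inf (q / z) (q^2) * qpoch_inf (q^2) (q^2))) UNIV"
proof -
  have q2: "norm (q^2) < 1"
    using q by (simp add: norm_power power_less_one_iff)
  define E where "E = qpoch_inf (q^2) (q^2)"
  have E: "E \<noteq> 0" using qpoch_inf_self_nonzero[OF q2] by (simp add: E_def)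
  obtain C where C: "C \<ge> 0" "\<And>i. norm (inv_qfact (q^2) i) \<le> C"
    using inv_qfact_bounded[OF q2] by blast
  let ?t = "\<lambda>r. (-z) powi r * q powi (r * r)"
  have "((\<lambda>r. ?t r * (1 / E * (1 / E))) has_sum
          (qpoch_inf (z * q) (q^2) * qpoch_inf (q / z) (q^2) / E)) UNIV"
  proof (rule has_sum_dominated_convergence[OF finite_jacobi_triple_product[OF q z]])
    show "norm (?t r * (inv_qfact (q^2) (int n - r) * inv_qfact (q^2) (int n + r)))
            \<le> norm (?t r) * (C * C)" for n r
      unfolding norm_mult[of "?t r"] norm_mult[of "inv_qfact _ _"]
      by (intro mult_left_mono mult_mono C norm_ge_zero)
    show "(\<lambda>r. norm (?t r) * (C * C)) summable_on UNIV"
      by (rule summable_on_cmult_left[OF abs_summable_theta]) (use q z in auto)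
    show "(\<lambda>n. ?t r * (inv_qfact (q^2) (int n - r) * inv_qfact (q^2) (int n + r)))
            \<longlonglongrightarrow> ?t r * (1 / E * (1 / E))" for r
      using inv_qfact_tendsto_shift[OF q2, of "- r"] inv_qfact_tendsto_shift[OF q2, of r]
      unfolding E_def by (intro tendsto_mult tendsto_const) simp_all
    have "(\<lambda>n. qpoch (q^2) (q^2) (2 * n)) \<longlonglongrightarrow> E"
      using LIMSEQ_subseq_LIMSEQ[OF qpoch_tendsto[OF q2], of "\<lambda>n. 2 * n" "q^2"]
      by (simp add: E_def o_def strict_mono_def)
    then show "(\<lambda>n. qpoch (z * q) (q^2) n * qpoch (q / z) (q^2) n / qpoch (q^2) (q^2) (2 * n))
            \<longlonglongrightarrow> qpoch_inf (z * q) (q^2) * qpoch_inf (q / z) (q^2) / E"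
      by (intro tendsto_divide tendsto_mult qpoch_tendsto q2 E)
  qed
  from has_sum_cmult_left[OF this, of "E * E"] show ?thesis
    using E by (simp add: E_def mult.assoc)
qed

section \<open>The quintuple product\<close>

lemma qpoch_inf_trisect:
  assumes "norm q < 1"
  shows "qpoch_inf a q = qpoch_inf a (q^3) * qpoch_inf (a * q) (q^3) * qpoch_inf (a * q^2) (q^3)"
proof (rule LIMSEQ_unique)
  have q3: "norm (q^3) < 1"
    using assms by (simp add: norm_power power_less_one_iff)
  have "qpoch a q (3 * n) = qpoch a (q^3) n * qpoch (a * q) (q^3) n * qpoch (a * q^2) (q^3) n" for n
  proof (induction n)
    case (Suc n)
    have "3 * Suc n = Suc (Suc (Suc (3 * n)))" by simp
    then show ?case
      by (simp only: qpoch_Suc Suc.IH) (simp add: power_mult[symmetric] power2_eq_square algebra_simps)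
  qed (simp add: qpoch_def)
  then have eq: "(\<lambda>n. qpoch a q (3 * n)) =
      (\<lambda>n. qpoch a (q^3) n * qpoch (a * q) (q^3) n * qpoch (a * q^2) (q^3) n)"
    by (rule ext)
  show "(\<lambda>n. qpoch a q (3 * n)) \<longlonglongrightarrow> qpoch_inf a q"
    using LIMSEQ_subseq_LIMSEQ[OF qpoch_tendsto[OF assms], of "\<lambda>n. 3 * n" a]
    by (simp add: o_def strict_mono_def)
  show "(\<lambda>n. qpoch a q (3 * n)) \<longlonglongrightarrow>
      qpoch_inf a (q^3) * qpoch_inf (a * q) (q^3) * qpoch_inf (a * q^2) (q^3)"
    unfolding eq by (intro tendsto_mult qpoch_tendsto q3)
qed

lemma pentagonal_number_theorem:
  assumes p: "norm p < 1" "p \<noteq> 0"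
  shows "((\<lambda>k. (-1) powi k * p powi (6 * k * k + 2 * k)) has_sum qpoch_inf (p^4) (p^4)) UNIV"
proof -
  have p': "norm (p^6) < 1" "p^6 \<noteq> 0" "p^2 \<noteq> 0" "norm (p^4) < 1"
    using p by (auto simp: norm_power power_less_one_iff)
  have "(- (p^2)) powi k * (p^6) powi (k * k) = (-1) powi k * p powi (6 * k * k + 2 * k)" for k
  proof -
    have "(- (p^2)) powi k = (-1) powi k * p powi (2 * k)"
      using power_int_mult_distrib[of "-1" "p^2" k] by (simp add: power_int_power)
    then show ?thesis
      using p by (simp add: power_int_power power_int_add mult_ac)
  qed
  moreover have "qpoch_inf (p^2 * p^6) ((p^6)^2) * qpoch_inf (p^6 / p^2) ((p^6)^2) * qpoch_inf ((p^6)^2) ((p^6)^2)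
      = qpoch_inf (p^4) (p^4)"
  proof -
    have "p^2 * p^6 = p^8" "p^6 / p^2 = p^4" "(p^6)^2 = p^12" "(p^4)^3 = p^12"
      "p^4 * p^4 = p^8" "p^4 * (p^4)^2 = p^12"
      using p by (auto simp: power_mult[symmetric] power_add[symmetric] power_diff[symmetric])
    then show ?thesis using qpoch_inf_trisect[OF p'(4), of "p^4"] by simp
  qed
  ultimately show ?thesis
    using jacobi_triple_product[OF p'(1-3)] by simp
qed

text \<open>
  The substitution k \<mapsto> 1 - k changes the sign of each term. The same conclusion appears
  in the triple product as a factor (1; p^12)_\<infinity> = 0.
\<close>

lemma sum_alternating_symmetric:
  fixes p :: complex
  assumes p: "norm p < 1" "p \<noteq> 0"
  shows "((\<lambda>k. (-1) powi k * p powi (6 * k * k - 6 * k)) has_sum 0) UNIV"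
proof -
  have p': "norm (p^6) < 1" "p^6 \<noteq> 0" "inverse (p^6) \<noteq> 0"
    using p by (auto simp: norm_power power_less_one_iff)
  have "(- inverse (p^6)) powi k * (p^6) powi (k * k) = (-1) powi k * p powi (6 * k * k - 6 * k)" for k
  proof -
    have "(- inverse (p^6)) powi k = (-1) powi k * inverse (p powi (6 * k))"
      using power_int_mult_distrib[of "-1" "inverse (p^6)" k]
      by (simp add: power_int_power power_int_inverse)
    then show ?thesis
      using p by (simp add: power_int_power power_int_diff mult_ac divide_inverse)
  qed
  moreover have "qpoch_inf (inverse (p^6) * p^6) ((p^6)^2) = 0"
  proof (rule LIMSEQ_unique)
    have "norm ((p^6)^2) < 1" using p'(1) by (simp add: norm_power power_less_one_iff)
    from qpoch_tendsto[OF this]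
    show "qpoch (inverse (p^6) * p^6) ((p^6)^2) \<longlonglongrightarrow> qpoch_inf (inverse (p^6) * p^6) ((p^6)^2)" .
    have "qpoch (inverse (p^6) * p^6) ((p^6)^2) (Suc n) = 0" for n
      using p by (simp add: qpoch_def prod.lessThan_Suc_shift del: prod.lessThan_Suc)
    then have "(\<lambda>n. qpoch (inverse (p^6) * p^6) ((p^6)^2) (Suc n)) \<longlonglongrightarrow> 0" by simp
    then show "qpoch (inverse (p^6) * p^6) ((p^6)^2) \<longlonglongrightarrow> 0" by (rule LIMSEQ_imp_Suc)
  qed
  ultimately show ?thesis
    using jacobi_triple_product[OF p'(1-3)] by simp
qed

lemma has_sum_product:
  fixes f :: "'a \<Rightarrow> complex" and g :: "'b \<Rightarrow> complex"
  assumes f: "(\<lambda>x. norm (f x)) summable_on A" "(f has_sum s) A"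
    and g: "(\<lambda>y. norm (g y)) summable_on B" "(g has_sum t) B"
  shows "((\<lambda>(x, y). f x * g y) has_sum s * t) (A \<times> B)"
proof (rule has_sum_SigmaI)
  show "((\<lambda>y. case (x, y) of (x, y) \<Rightarrow> f x * g y) has_sum f x * t) B" for x
    using has_sum_cmult_right[OF g(2)] by simp
  show "((\<lambda>x. f x * t) has_sum s * t) A"
    by (rule has_sum_cmult_left[OF f(2)])
  have "(\<lambda>z. norm (case z of (x, y) \<Rightarrow> f x * g y)) summable_on A \<times> B"
  proof (rule summable_on_SigmaI)
    show "((\<lambda>y. norm (case (x, y) of (x, y) \<Rightarrow> f x * g y)) has_sum
        norm (f x) * infsum (\<lambda>y. norm (g y)) B) B" for x
      using has_sum_cmult_right[OF has_sum_infsum[OF g(1)], of "norm (f x)"]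
      by (simp add: norm_mult)
    show "(\<lambda>x. norm (f x) * infsum (\<lambda>y. norm (g y)) B) summable_on A"
      by (rule summable_on_cmult_left[OF f(1)])
  qed simp
  then show "(\<lambda>(x, y). f x * g y) summable_on A \<times> B"
    by (rule abs_summable_summable)
qed

text \<open>
  The product Q(p^2, x) is, up to a factor (p^4; p^4)_\<infinity>, a product of two triple products,
  one in x and the other in x^2. Multiply the two theta series and collect
  the terms with total exponent N = m + 2n of x. Completing the square in the exponent of p, with
  a shift of n by N div 3, leaves a sum that depends only on N mod 3: for the residues 0 and 1 it is the
  pentagonal number series, equal to (p^4; p^4)_\<infinity>, and for the residue 2 it is antisymmetric
  and vanishes. The unwanted factor cancels.
\<close>

theorem quintuple_product:
  assumes p: "norm p < 1" "p \<noteq> 0" and x: "x \<noteq> 0"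
  shows "((\<lambda>M. (-1) powi M * p powi (3 * M * M + M) * (x powi (-3 * M) + x powi (3 * M + 1)))
           has_sum Q (p^2) x) UNIV"
proof -
  have p2: "norm (p^2) < 1" "p^2 \<noteq> 0" and p4: "norm (p^4) < 1"
    using p by (auto simp: norm_power power_less_one_iff)
  define E where "E = qpoch_inf (p^4) (p^4)"
  have E: "E \<noteq> 0" using qpoch_inf_self_nonzero[OF p4] by (simp add: E_def)
  \<comment> \<open>The theta series of the triple products with parameters z = - x / p, base p, and z = x^2, base p^2.\<close>
  define a where "a m = (x / p) powi m * p powi (m * m)" for m :: int
  define b where "b n = (- (x^2)) powi n * (p^2) powi (n * n)" for n :: int
  have "(a has_sum (qpoch_inf (- x) (p^2) * qpoch_inf (- (p^2 / x)) (p^2) * qpoch_inf (p^2) (p^2))) UNIV"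
    using jacobi_triple_product[OF p, of "- (x / p)"] p x
    by (simp add: a_def[abs_def] power2_eq_square)
  moreover have "(b has_sum (qpoch_inf (x^2 * p^2) (p^4) * qpoch_inf (p^2 / x^2) (p^4) * E)) UNIV"
    using jacobi_triple_product[OF p2, of "x^2"] x
    by (simp add: b_def[abs_def] E_def flip: power_mult)
  moreover have "(\<lambda>m. norm (a m)) summable_on UNIV"
    unfolding a_def by (rule abs_summable_theta) (use p x in auto)
  moreover have "(\<lambda>n. norm (b n)) summable_on UNIV"
    unfolding b_def by (rule abs_summable_theta) (use p2 x in auto)
  ultimately have "((\<lambda>(m, n). a m * b n) has_sum
      ((qpoch_inf (- x) (p^2) * qpoch_inf (- (p^2 / x)) (p^2) * qpoch_inf (p^2) (p^2)) *
       (qpoch_inf (x^2 * p^2) (p^4) * qpoch_inf (p^2 / x^2) (p^4) * E))) (UNIV \<times> UNIV)"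
    by (intro has_sum_product)
  also have "(qpoch_inf (- x) (p^2) * qpoch_inf (- (p^2 / x)) (p^2) * qpoch_inf (p^2) (p^2)) *
       (qpoch_inf (x^2 * p^2) (p^4) * qpoch_inf (p^2 / x^2) (p^4) * E) = E * Q (p^2) x"
    by (simp add: Q_def qpochs_inf_def divide_inverse power_inverse mult_ac flip: power_mult)
  finally have ab: "((\<lambda>(m, n). a m * b n) has_sum E * Q (p^2) x) (UNIV \<times> UNIV)" .
  define G where "G N n = (-1) powi n * x powi N * p powi (6 * n * n + 2 * n - 4 * n * N + N * N - N)"
    for N n :: int
  have G: "a (N - 2 * n) * b n = G N n" for N n
  proof -
    have "a (N - 2 * n) = x powi (N - 2 * n) * p powi ((N - 2 * n) * (N - 2 * n) - (N - 2 * n))"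
      using p by (simp add: a_def power_int_divide_distrib power_int_diff)
    moreover have "b n = (-1) powi n * x powi (2 * n) * p powi (2 * (n * n))"
      using power_int_mult_distrib[of "-1" "x^2" n] by (simp add: b_def power_int_power)
    ultimately have "a (N - 2 * n) * b n = (-1) powi n * (x powi (N - 2 * n) * x powi (2 * n)) *
        (p powi ((N - 2 * n) * (N - 2 * n) - (N - 2 * n)) * p powi (2 * (n * n)))"
      by (simp add: mult_ac)
    also have "x powi (N - 2 * n) * x powi (2 * n) = x powi N"
      using x by (simp flip: power_int_add)
    also have "p powi ((N - 2 * n) * (N - 2 * n) - (N - 2 * n)) * p powi (2 * (n * n)) =
        p powi (6 * n * n + 2 * n - 4 * n * N + N * N - N)"
      using p by (simp flip: power_int_add) (simp add: algebra_simps)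
    finally show ?thesis by (simp add: G_def)
  qed
  have NG: "((\<lambda>(N, n). G N n) has_sum E * Q (p^2) x) (UNIV \<times> UNIV)"
    by (subst has_sum_reindex_bij_witness[where i = "\<lambda>(m, n). (m + 2 * n, n)"
          and j = "\<lambda>(N, n). (N - 2 * n, n)", OF _ _ _ _ _ refl])
       (use ab in \<open>auto simp: G\<close>)
  \<comment> \<open>The coefficient sum for exponent N of x, with E the value of the pentagonal number series.\<close>
  define R where "R N = (if N mod 3 = 0 then (-1) powi (N div 3) * x powi N * p powi (3 * (N div 3) * (N div 3) - N div 3) * E
     else if N mod 3 = 1 then (-1) powi (N div 3) * x powi N * p powi (3 * (N div 3) * (N div 3) + N div 3) * E else 0)" for N
  have row: "(G N has_sum R N) UNIV" for N
  proof -
    define M where "M = N div 3"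
    have sgn: "(-1) powi (M + k) = (-1) powi M * ((-1) powi k :: complex)" for k
      by (simp add: power_int_add)
    have sgn': "(-1) powi (M - k) = (-1) powi M * ((-1) powi k :: complex)" for k
      using power_int_add[of "-1 :: complex" M "- k"] by (simp add: power_int_minus_one_minus)
    have reidx: "(G N has_sum c * s) UNIV"
      if "\<And>k. G N (M + t * k) = c * e k" "(e has_sum s) UNIV" "t = 1 \<or> t = -1" for c s e t
    proof -
      have "(G N has_sum c * s) UNIV = ((\<lambda>k. c * e k) has_sum c * s) UNIV"
        by (rule has_sum_reindex_bij_witness[where i = "\<lambda>k. M + t * k" and j = "\<lambda>n. t * (n - M)"])
           (use that(3) in \<open>auto simp: that(1)[symmetric]\<close>)
      then show ?thesis using has_sum_cmult_right[OF that(2)] by simp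
    qed
    consider "N = 3 * M" | "N = 3 * M + 1" | "N = 3 * M + 2"
      unfolding M_def by linarith
    then show ?thesis
    proof cases
      case 1
      have h: "G N (M + 1 * k) = ((-1) powi M * x powi N * p powi (3 * M * M - M)) *
          ((-1) powi k * p powi (6 * k * k + 2 * k))" for k
      proof -
        have e: "6 * (M + 1 * k) * (M + 1 * k) + 2 * (M + 1 * k) - 4 * (M + 1 * k) * N + N * N - N
            = (3 * M * M - M) + (6 * k * k + 2 * k)"
          unfolding 1 by (simp add: algebra_simps)
        show ?thesis
          unfolding G_def e power_int_add[OF disjI1[OF p(2)], of "3 * M * M - M"]
          by (simp add: sgn mult_ac)
      qed
      have "N mod 3 = 0" using 1 by presburger
      then show ?thesis
        using reidx[OF h pentagonal_number_theorem[OF p]] by (simp add: R_def E_def flip: M_def)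
    next
      case 2
      have h: "G N (M + (-1) * k) = ((-1) powi M * x powi N * p powi (3 * M * M + M)) *
          ((-1) powi k * p powi (6 * k * k + 2 * k))" for k
      proof -
        have e: "6 * (M + (-1) * k) * (M + (-1) * k) + 2 * (M + (-1) * k) - 4 * (M + (-1) * k) * N + N * N - N
            = (3 * M * M + M) + (6 * k * k + 2 * k)"
          unfolding 2 by (simp add: algebra_simps)
        show ?thesis
          unfolding G_def e power_int_add[OF disjI1[OF p(2)], of "3 * M * M + M"]
          by (simp add: sgn' mult_ac)
      qed
      have "N mod 3 = 1" using 2 by presburger
      then show ?thesis
        using reidx[OF h pentagonal_number_theorem[OF p]] by (simp add: R_def E_def flip: M_def)
    next
      case 3
      have h: "G N (M + 1 * k) = ((-1) powi M * x powi N * p powi (3 * M * M + 3 * M + 2)) *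
          ((-1) powi k * p powi (6 * k * k - 6 * k))" for k
      proof -
        have e: "6 * (M + 1 * k) * (M + 1 * k) + 2 * (M + 1 * k) - 4 * (M + 1 * k) * N + N * N - N
            = (3 * M * M + 3 * M + 2) + (6 * k * k - 6 * k)"
          unfolding 3 by (simp add: algebra_simps)
        show ?thesis
          unfolding G_def e power_int_add[OF disjI1[OF p(2)], of "3 * M * M + 3 * M + 2"]
          by (simp add: sgn mult_ac)
      qed
      have "N mod 3 = 2" using 3 by presburger
      then show ?thesis
        using reidx[OF h sum_alternating_symmetric[OF p]] by (simp add: R_def)
    qed
  qed
  have "(R has_sum E * Q (p^2) x) UNIV"
    by (rule has_sum_SigmaD[OF NG]) (simp add: row)
  \<comment> \<open>Pairing N = - 3 M with N = 3 M + 1 gives both terms the same power of p.\<close>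
  moreover have ndvd: "\<not> 3 dvd 3 * a + (1 :: int)" "\<not> 3 dvd 3 * a + (2 :: int)" for a by presburger+
  ultimately have "((\<lambda>(M, i). R (if i = 0 then - 3 * M else 3 * M + i)) has_sum E * Q (p^2) x) (UNIV \<times> {0, 1, 2})"
    by (subst has_sum_reindex_bij_witness[
          where i = "\<lambda>N. (if N mod 3 = 0 then - (N div 3) else N div 3, N mod 3)"
          and j = "\<lambda>(M, i). if i = 0 then - 3 * M else 3 * M + i" and T = UNIV and h = R, OF _ _ _ _ _ refl])
       (use ndvd in auto)
  then have "((\<lambda>M. \<Sum>i\<in>{0, 1, 2}. R (if i = 0 then - 3 * M else 3 * M + i)) has_sum E * Q (p^2) x) UNIV"
    by (rule has_sum_SigmaD) (auto intro!: has_sum_finiteI)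
  moreover have "(\<Sum>i\<in>{0, 1, 2}. R (if i = 0 then - 3 * M else 3 * M + i)) =
      E * ((-1) powi M * p powi (3 * M * M + M) * (x powi (-3 * M) + x powi (3 * M + 1)))" for M
  proof -
    have d: "- 3 * M div 3 = - M" "- 3 * M mod 3 = 0" "(3 * M + 1) div 3 = M" "(3 * M + 1) mod 3 = 1"
      "(3 * M + 2) mod 3 = 2" by presburger+
    have "R (- 3 * M) = (-1) powi M * x powi (- 3 * M) * p powi (3 * M * M + M) * E"
      unfolding R_def d by (simp add: power_int_minus_one_minus)
    moreover have "R (3 * M + 1) = (-1) powi M * x powi (3 * M + 1) * p powi (3 * M * M + M) * E"
      unfolding R_def d by simp
    moreover have "R (3 * M + 2) = 0"
      unfolding R_def d by simp
    ultimately show ?thesis by (simp add: algebra_simps)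
  qed
  ultimately show ?thesis
    using E by (simp add: has_sum_cmult_right_iff)
qed

section \<open>A weak form of Bailey's lemma\<close>

text \<open>
  Classically, the k-th term enumerates the partitions whose Durfee rectangle, the largest
  one of shape k by k + m in the diagram, has this k. Analytically, if t m k denotes the term, then t m k - t (m + 1) k telescopes
  in k with potential G k = t m k (1 - q^k). Hence the sum is independent of m,
  and for m \<rightarrow> \<infinity> only the term k = 0 survives.
\<close>

lemma durfee_rectangle_sum:
  assumes q: "norm q < 1"
  shows "((\<lambda>k. q ^ (k * k + m * k) / (qpoch q q k * qpoch q q (k + m))) has_sum 1 / qpoch_inf q q) UNIV"
proof -
  define t where "t m k = q ^ (k * k + m * k) / (qpoch q q k * qpoch q q (k + m))" for m k
  obtain C where C: "C \<ge> 0" "\<And>i. norm (inv_qfact q i) \<le> C"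
    using inv_qfact_bounded[OF q] by blast
  have nz: "qpoch q q n \<noteq> 0" "1 - q ^ Suc n \<noteq> 0" for n
    using qpoch_self_nonzero[OF q] one_minus_power_nonzero[OF q, of "Suc n"] by auto
  have bound: "norm (t m k) \<le> norm q ^ k * (C * C)" for m k
  proof -
    have "t m k = q ^ (k * k + m * k) * (inv_qfact q (int k) * inv_qfact q (int (k + m)))"
      by (simp only: inv_qfact_of_nat t_def) simp
    also have "norm \<dots> = norm q ^ (k * k + m * k) * (norm (inv_qfact q (int k)) * norm (inv_qfact q (int (k + m))))"
      by (simp only: norm_mult norm_power)
    also have "\<dots> \<le> norm q ^ k * (C * C)"
    proof (intro mult_mono C mult_nonneg_nonneg norm_ge_zero zero_le_power)
      have "k \<le> k * k + m * k" by (cases k) auto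
      then show "norm q ^ (k * k + m * k) \<le> norm q ^ k"
        using q by (intro power_decreasing) auto
    qed
    finally show ?thesis .
  qed
  have g: "(\<lambda>k. norm q ^ k * (C * C)) summable_on UNIV"
    using C summable_mult2[OF summable_geometric[of "norm q"]] q
    by (subst summable_on_UNIV_nonneg_real_iff) simp_all
  have "t m summable_on UNIV" for m
    by (rule abs_summable_summable[OF Infinite_Sum.abs_summable_on_comparison_test'[OF g bound]])
  then have t: "(t m has_sum infsum (t m) UNIV) UNIV" for m by simp
  have step: "infsum (t m) UNIV = infsum (t (Suc m)) UNIV" for m
  proof -
    \<comment> \<open>The potential whose differences are those of t m and t (Suc m); it vanishes at k = 0.\<close>
    define G where "G k = t m k * (1 - q ^ k)" for k
    have "t m k - t (Suc m) k = G k - G (Suc k)" for k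
    proof -
      define W a b D where "W = q ^ (k * k + m * k)" and "a = q ^ k" and "b = q ^ Suc (k + m)"
        and "D = qpoch q q k * (qpoch q q (k + m) * (1 - q ^ Suc (k + m)))"
      have "Suc k * Suc k + m * Suc k = k * k + m * k + (k + Suc (k + m))" by simp
      then have "t m (Suc k) = W * (a * b) /
          (qpoch q q k * (1 - q ^ Suc k) * (qpoch q q (k + m) * (1 - q ^ Suc (k + m))))"
        unfolding t_def W_def a_def b_def by (simp only: power_add add_Suc qpoch_Suc power_Suc)
      then have "G (Suc k) = W * (a * b) / D"
        unfolding G_def D_def using nz(2)[of k] by (simp del: power_Suc)
      moreover have "t (Suc m) k = W * a / D"
        unfolding t_def W_def a_def D_def
        by (simp only: add_Suc_right qpoch_Suc power_Suc[symmetric] power_add mult_Suc)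
           (simp add: power_add mult_ac)
      moreover have "t m k = W * (1 - b) / D"
        unfolding t_def W_def b_def D_def using nz(2)[of "k + m"] by (simp del: power_Suc)
      moreover have "G k = W * (1 - b) / D * (1 - a)"
        unfolding G_def \<open>t m k = W * (1 - b) / D\<close> by (simp add: a_def)
      ultimately show ?thesis
        by (simp only: times_divide_eq_left diff_divide_distrib[symmetric]) (simp add: algebra_simps)
    qed
    moreover have "G \<longlonglongrightarrow> 0 * (1 - 0)"
      unfolding G_def using q
      by (intro tendsto_mult tendsto_diff tendsto_const summable_LIMSEQ_zero summable_on_imp_summable
          LIMSEQ_power_zero has_sum_imp_summable[OF t])
    ultimately have "(\<lambda>k. t m k - t (Suc m) k) sums (G 0 - 0)"
      using telescope_sums'[of G 0] by simp
    then have "(\<lambda>k. t m k - t (Suc m) k) sums 0"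
      by (simp add: G_def)
    moreover have "(\<lambda>k. t m k - t (Suc m) k) sums (infsum (t m) UNIV - infsum (t (Suc m)) UNIV)"
      by (intro sums_diff has_sum_imp_sums t)
    ultimately show ?thesis using sums_unique2 by fastforce
  qed
  have const: "infsum (t m) UNIV = infsum (t 0) UNIV" for m
    by (induction m) (simp_all flip: step)
  \<comment> \<open>The termwise limit for m tending to infinity.\<close>
  define h where "h k = q ^ (k * k) * (if k = 0 then 1 else 0) / (qpoch q q k * qpoch_inf q q)" for k
  have "(h has_sum infsum (t 0) UNIV) UNIV"
  proof (rule has_sum_dominated_convergence[OF t bound g])
    show "(\<lambda>m. t m k) \<longlonglongrightarrow> h k" for k
    proof -
      have "(\<lambda>m. (q ^ k) ^ m) \<longlonglongrightarrow> (if k = 0 then 1 else 0)"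
        using q by (auto intro!: LIMSEQ_power_zero simp: norm_power power_less_one_iff)
      moreover have "(\<lambda>m. qpoch q q (k + m)) \<longlonglongrightarrow> qpoch_inf q q"
        using LIMSEQ_ignore_initial_segment[OF qpoch_tendsto[OF q], of q k] by (simp add: add.commute)
      ultimately have "(\<lambda>m. q ^ (k * k) * (q ^ k) ^ m / (qpoch q q k * qpoch q q (k + m))) \<longlonglongrightarrow> h k"
        unfolding h_def using nz qpoch_inf_self_nonzero[OF q]
        by (intro tendsto_divide tendsto_mult tendsto_const) auto
      then show ?thesis by (simp add: t_def power_add mult.commute flip: power_mult)
    qed
    show "(\<lambda>m. infsum (t m) UNIV) \<longlonglongrightarrow> infsum (t 0) UNIV"
      by (rule Lim_transform_eventually[OF tendsto_const])
         (rule always_eventually, rule allI, rule const[symmetric])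
  qed
  moreover have "(h has_sum 1 / qpoch_inf q q) UNIV"
    by (rule has_sum_finite_neutralI[of "{0}"]) (auto simp: h_def qpoch_def)
  ultimately have "infsum (t 0) UNIV = 1 / qpoch_inf q q"
    by (rule has_sum_unique)
  with t[of m] const[of m] show ?thesis by (simp add: t_def[abs_def])
qed

text \<open>
  For a fixed s, the substitution n = s + k turns the sum over n into a Durfee rectangle sum
  with m = 2s + 1, whose value does not depend on s. So the statement is an
  interchange of two summations, justified because n^2 + n \<ge> s + n for s \<le> n dominates
  the double series by a product of geometric ones.
\<close>

lemma weak_bailey_lemma:
  fixes \<alpha> :: "nat \<Rightarrow> complex"
  assumes q: "norm q < 1"
    and bounded: "\<And>s. norm (\<alpha> s) \<le> B"
    and sum: "((\<lambda>s. q ^ (s * s + s) * \<alpha> s) has_sum A) UNIV"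
  shows "((\<lambda>n. q ^ (n * n + n) * (\<Sum>s\<le>n. \<alpha> s / (qpoch q q (n - s) * qpoch q q (n + s + 1))))
           has_sum A / qpoch_inf q q) UNIV"
proof -
  obtain C where C: "C \<ge> 0" "\<And>i. norm (inv_qfact q i) \<le> C"
    using inv_qfact_bounded[OF q] by blast
  have B: "B \<ge> 0" using bounded[of 0] norm_ge_zero order_trans by blast
  define F where "F = (\<lambda>(s, n). if s \<le> n
      then q ^ (n * n + n) * (\<alpha> s / (qpoch q q (n - s) * qpoch q q (n + s + 1))) else 0)"
  have geom: "((\<lambda>n. q ^ n) has_sum 1 / (1 - q)) UNIV" "(\<lambda>n. norm (q ^ n)) summable_on UNIV"
  proof -
    have s: "summable (\<lambda>n. norm (q ^ n))"
      using q by (simp add: norm_power summable_geometric)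
    then show "((\<lambda>n. q ^ n) has_sum 1 / (1 - q)) UNIV"
      by (rule norm_summable_imp_has_sum) (rule geometric_sums[OF q])
    show "(\<lambda>n. norm (q ^ n)) summable_on UNIV"
      using s by (subst summable_on_UNIV_nonneg_real_iff) auto
  qed
  have "(\<lambda>(s, n). q ^ s * q ^ n) summable_on (UNIV \<times> UNIV)"
    using has_sum_product[OF geom(2,1) geom(2,1)] has_sum_imp_summable by blast
  then have "(\<lambda>x. norm (case x of (s, n) \<Rightarrow> q ^ s * q ^ n)) summable_on (UNIV \<times> UNIV)"
    by (simp add: summable_on_iff_abs_summable_on_complex)
  then have g: "(\<lambda>x. norm (case x of (s, n) \<Rightarrow> q ^ s * q ^ n) * (B * (C * C))) summable_on (UNIV \<times> UNIV)"
    by (rule summable_on_cmult_left)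
  have "norm (F x) \<le> norm (case x of (s, n) \<Rightarrow> q ^ s * q ^ n) * (B * (C * C))" for x
  proof -
    obtain s n where x: "x = (s, n)" by (cases x)
    show ?thesis
    proof (cases "s \<le> n")
      case True
      have "F x = q ^ (n * n + n) * (\<alpha> s * (inv_qfact q (int (n - s)) * inv_qfact q (int (n + s + 1))))"
        using True by (simp only: inv_qfact_of_nat) (simp add: F_def x)
      also have "norm \<dots> = norm q ^ (n * n + n) * (norm (\<alpha> s) *
          (norm (inv_qfact q (int (n - s))) * norm (inv_qfact q (int (n + s + 1)))))"
        by (simp only: norm_mult norm_power)
      also have "\<dots> \<le> norm q ^ (s + n) * (B * (C * C))"
      proof (intro mult_mono C B bounded mult_nonneg_nonneg norm_ge_zero zero_le_power)
        have "s + n \<le> n * n + n" using True le_square[of n] by linarith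
        then show "norm q ^ (n * n + n) \<le> norm q ^ (s + n)"
          using q by (intro power_decreasing) auto
      qed
      finally show ?thesis by (simp add: x norm_mult norm_power power_add)
    next
      case False
      then show ?thesis using B C by (simp add: F_def x)
    qed
  qed
  then have "F summable_on (UNIV \<times> UNIV)"
    by (intro abs_summable_summable[OF Infinite_Sum.abs_summable_on_comparison_test'[OF g]])
  then have F: "(F has_sum infsum F (UNIV \<times> UNIV)) (UNIV \<times> UNIV)" by simp
  have "((\<lambda>n. F (s, n)) has_sum (q ^ (s * s + s) * \<alpha> s) * (1 / qpoch_inf q q)) UNIV" for s
  proof -
    define m where "m = 2 * s + 1"
    have "((\<lambda>n. F (s, n)) has_sum (q ^ (s * s + s) * \<alpha> s) * (1 / qpoch_inf q q)) {s..}
      = ((\<lambda>k. (q ^ (s * s + s) * \<alpha> s) * (q ^ (k * k + m * k) / (qpoch q q k * qpoch q q (k + m))))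
          has_sum (q ^ (s * s + s) * \<alpha> s) * (1 / qpoch_inf q q)) UNIV"
    proof (rule has_sum_reindex_bij_witness[where i = "\<lambda>k. k + s" and j = "\<lambda>n. n - s"])
      fix n assume "n \<in> {s..}"
      then obtain k where n: "n = k + s" by (metis atLeast_iff le_add_diff_inverse2)
      have "(k + s) * (k + s) + (k + s) = (s * s + s) + (k * k + m * k)"
        by (simp add: m_def algebra_simps)
      then have "q ^ ((k + s) * (k + s) + (k + s)) = q ^ (s * s + s) * q ^ (k * k + m * k)"
        by (simp only: power_add)
      moreover have "k + s + s + 1 = k + m" by (simp add: m_def)
      ultimately show "q ^ (s * s + s) * \<alpha> s * (q ^ ((n - s) * (n - s) + m * (n - s)) /
          (qpoch q q (n - s) * qpoch q q (n - s + m))) = F (s, n)"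
        unfolding F_def n by (simp only: prod.case) simp
    qed auto
    moreover have "((\<lambda>n. F (s, n)) has_sum c) UNIV = ((\<lambda>n. F (s, n)) has_sum c) {s..}" for c
      by (rule has_sum_cong_neutral) (auto simp: F_def)
    ultimately show ?thesis
      using has_sum_cmult_right[OF durfee_rectangle_sum[OF q]] by blast
  qed
  with F have "((\<lambda>s. (q ^ (s * s + s) * \<alpha> s) * (1 / qpoch_inf q q)) has_sum infsum F (UNIV \<times> UNIV)) UNIV"
    by (rule has_sum_SigmaD)
  moreover have "((\<lambda>s. (q ^ (s * s + s) * \<alpha> s) * (1 / qpoch_inf q q)) has_sum A * (1 / qpoch_inf q q)) UNIV"
    by (rule has_sum_cmult_left[OF sum])
  ultimately have "infsum F (UNIV \<times> UNIV) = A / qpoch_inf q q"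
    using has_sum_unique by fastforce
  with F have "((\<lambda>(n, s). F (s, n)) has_sum A / qpoch_inf q q) (UNIV \<times> UNIV)"
    by (subst (asm) has_sum_swap) simp
  then show ?thesis
  proof (rule has_sum_SigmaD)
    show "((\<lambda>s. case (n, s) of (n, s) \<Rightarrow> F (s, n)) has_sum
        q ^ (n * n + n) * (\<Sum>s\<le>n. \<alpha> s / (qpoch q q (n - s) * qpoch q q (n + s + 1)))) UNIV" for n
      by (rule has_sum_finite_neutralI[of "{..n}"]) (auto simp: F_def sum_distrib_left)
  qed
qed

section \<open>The Bailey pair\<close>

definition laurent_partial_sum :: "complex \<Rightarrow> nat \<Rightarrow> complex" where
  "laurent_partial_sum z s = (\<Sum>r = - int s..int s. z powi r)"

lemma sum_int_interval_Suc:
  fixes f :: "int \<Rightarrow> complex"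
  shows "(\<Sum>r = - int (Suc s)..int (Suc s). f r) =
           (\<Sum>r = - int s..int s. f r) + f (int (Suc s)) + f (- int (Suc s))"
proof -
  have "{- int (Suc s)..int (Suc s)} = insert (int (Suc s)) (insert (- int (Suc s)) {- int s..int s})"
    by auto
  then show ?thesis by simp
qed

text \<open>
  Summation by parts in \<bar>r\<bar>: the weights z^r and z^(-r) always occur with the same value of y,
  and their partial sums are the Laurent polynomials c(s), the sum of z^r over \<bar>r\<bar> \<le> s.
\<close>

lemma symmetric_sum_by_parts:
  fixes y :: "int \<Rightarrow> complex"
  assumes sym: "\<And>r. y (- r) = y r" and last: "y (int (Suc n)) = 0"
  shows "(\<Sum>r = - int n..int n. z powi r * y r) =
           (\<Sum>s\<le>n. laurent_partial_sum z s * (y (int s) - y (int (Suc s))))"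
proof -
  have "(\<Sum>s\<le>N. laurent_partial_sum z s * (y (int s) - y (int (Suc s)))) =
      (\<Sum>r = - int N..int N. z powi r * y r) - laurent_partial_sum z N * y (int (Suc N))" for N
  proof (induction N)
    case 0
    show ?case by (simp add: laurent_partial_sum_def)
  next
    case (Suc N)
    have c: "laurent_partial_sum z (Suc N) =
        laurent_partial_sum z N + z powi int (Suc N) + z powi (- int (Suc N))"
      unfolding laurent_partial_sum_def by (rule sum_int_interval_Suc)
    show ?case
      unfolding sum.atMost_Suc Suc.IH sum_int_interval_Suc sym c by (simp only: algebra_simps)
  qed
  from this[of n] show ?thesis unfolding last by simp
qed

text \<open>
  The finite triple product expands the left-hand side, without the factor 1 - q^(2n+1), in terms of
  1 / ((q^2; q^2)_{n-r} (q^2; q^2)_{n+r}). Write U(r) for this expression, and T(r) for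
  the one with n + r + 1 instead of n + r. The identity
  U(r) + q^(2r+1) U(r+1) = (1 + q^(2r+1)) (1 - q^(2n+1)) T(r) says that the differences
  of the coefficients (-1)^r q^(r^2) U(r) are divisible by precisely the missing factor and
  are multiples of T(r). Summation by parts introduces these differences.
\<close>

lemma bailey_pair_two_parameter:
  assumes q: "norm q < 1" "q \<noteq> 0" and z: "z \<noteq> 0"
  defines "\<alpha> \<equiv> \<lambda>s. (-1) ^ s * q ^ (s * s) * (1 + q ^ (2 * s + 1)) * laurent_partial_sum z s"
  shows "qpoch (z * q) (q^2) n * qpoch (q / z) (q^2) n / (qpoch (q^2) (q^2) (2 * n) * (1 - q ^ (2 * n + 1)))
       = (\<Sum>s\<le>n. \<alpha> s / (qpoch (q^2) (q^2) (n - s) * qpoch (q^2) (q^2) (n + s + 1)))"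
proof -
  have q2: "norm (q^2) < 1"
    using q by (simp add: norm_power power_less_one_iff)
  define P where "P = qpoch (z * q) (q^2) n * qpoch (q / z) (q^2) n / qpoch (q^2) (q^2) (2 * n)"
  define y where "y r = (-1) powi r * q powi (r * r) *
      (inv_qfact (q^2) (int n - r) * inv_qfact (q^2) (int n + r))" for r
  define w where "w = q ^ (2 * n + 1)"
  have w: "1 - w \<noteq> 0"
    unfolding w_def using one_minus_power_nonzero[OF q(1), of "2 * n + 1"] by simp
  have "((\<lambda>r. z powi r * y r) has_sum P) UNIV"
  proof -
    have "(- z) powi r = z powi r * (-1) powi r" for r
      using power_int_mult_distrib[of z "-1" r] by simp
    then show ?thesis
      using finite_jacobi_triple_product[OF q z, of n] by (simp add: y_def P_def mult.assoc)
  qed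
  moreover have "((\<lambda>r. z powi r * y r) has_sum (\<Sum>r = - int n..int n. z powi r * y r)) UNIV"
  proof (rule has_sum_finite_neutralI[of "{- int n..int n}"])
    fix r assume "r \<in> UNIV - {- int n..int n}"
    then have "int n - r < 0 \<or> int n + r < 0" by auto
    then show "z powi r * y r = 0" by (auto simp: y_def inv_qfact_def)
  qed auto
  ultimately have "P = (\<Sum>r = - int n..int n. z powi r * y r)"
    by (rule has_sum_unique)
  also have "\<dots> = (\<Sum>s\<le>n. laurent_partial_sum z s * (y (int s) - y (int (Suc s))))"
  proof (rule symmetric_sum_by_parts)
    show "y (- r) = y r" for r
      by (simp add: y_def power_int_minus_one_minus mult.commute)
    show "y (int (Suc n)) = 0"
      by (simp add: y_def inv_qfact_def)
  qed
  also have "\<dots> = (\<Sum>s\<le>n. (1 - w) * (\<alpha> s / (qpoch (q^2) (q^2) (n - s) * qpoch (q^2) (q^2) (n + s + 1))))"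
  proof (rule sum.cong[OF refl])
    fix s assume "s \<in> {..n}"
    then have s: "s \<le> n" by simp
    define a b T where "a = q ^ (2 * s + 1)" and "b = (q^2) ^ (n - s)"
      and "T = inv_qfact (q^2) (int (n - s)) * inv_qfact (q^2) (int (n + s + 1))"
    have aw: "(q^2) ^ (n + s + 1) = a * w" "a * b = w"
    proof -
      have "2 * (n + s + 1) = (2 * s + 1) + (2 * n + 1)" "(2 * s + 1) + 2 * (n - s) = 2 * n + 1"
        using s by auto
      then show "(q^2) ^ (n + s + 1) = a * w" "a * b = w"
        unfolding a_def b_def w_def by (metis power_add power_mult)+
    qed
    have "inv_qfact (q^2) (int n + int s) = (1 - a * w) * inv_qfact (q^2) (int (n + s + 1))"
      using inv_qfact_pred[OF q2, of "int (n + s + 1)"] unfolding power_int_of_nat aw by simp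
    moreover have "int n - int s = int (n - s)" using s by simp
    ultimately have y1: "y (int s) = (-1) ^ s * q ^ (s * s) * ((1 - a * w) * T)"
      unfolding y_def T_def of_nat_mult[symmetric] power_int_of_nat by (simp only: mult_ac)
    have "inv_qfact (q^2) (int n - int (Suc s)) = (1 - b) * inv_qfact (q^2) (int (n - s))"
      using inv_qfact_pred[OF q2, of "int (n - s)"] s
      unfolding power_int_of_nat b_def[symmetric] by (simp add: of_nat_diff diff_diff_eq add.commute)
    moreover have "int n + int (Suc s) = int (n + s + 1)" by simp
    moreover have "q ^ (Suc s * Suc s) = q ^ (s * s) * a"
      unfolding a_def power_add[symmetric] by (rule arg_cong[where f = "power q"]) simp
    ultimately have y2: "y (int (Suc s)) = - ((-1) ^ s * q ^ (s * s) * (a * (1 - b) * T))"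
      unfolding y_def T_def of_nat_mult[symmetric] power_int_of_nat power_Suc
      by (simp only: mult_minus1) (simp only: mult_minus_left mult_minus_right mult_ac)
    have "a * (1 - b) = a - w"
      using aw(2) by (simp add: algebra_simps)
    then have "y (int s) - y (int (Suc s)) = (-1) ^ s * q ^ (s * s) * ((1 + a) * (1 - w) * T)"
      unfolding y1 y2 by (simp add: algebra_simps)
    moreover have "T = 1 / (qpoch (q^2) (q^2) (n - s) * qpoch (q^2) (q^2) (n + s + 1))"
      unfolding T_def inv_qfact_of_nat by simp
    ultimately show "laurent_partial_sum z s * (y (int s) - y (int (Suc s))) =
        (1 - w) * (\<alpha> s / (qpoch (q^2) (q^2) (n - s) * qpoch (q^2) (q^2) (n + s + 1)))"
      by (simp add: \<alpha>_def a_def)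
  qed
  also have "\<dots> = (1 - w) * (\<Sum>s\<le>n. \<alpha> s / (qpoch (q^2) (q^2) (n - s) * qpoch (q^2) (q^2) (n + s + 1)))"
    by (rule sum_distrib_left[symmetric])
  finally have "P / (1 - w) = (\<Sum>s\<le>n. \<alpha> s / (qpoch (q^2) (q^2) (n - s) * qpoch (q^2) (q^2) (n + s + 1)))"
    using w by simp
  then show ?thesis by (simp add: P_def w_def)
qed

section \<open>Specialization to a cube root of unity\<close>

lemma cube_root_of_unity:
  obtains \<omega> :: complex where "\<omega> ^ 3 = 1" "1 + \<omega> + \<omega>\<^sup>2 = 0"
proof -
  define \<omega> where "\<omega> = Complex (-1/2) (sqrt 3 / 2)"
  have "\<omega>\<^sup>2 = Complex (-1/2) (- sqrt 3 / 2)"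
    by (simp add: \<omega>_def power2_eq_square complex_eq_iff)
  then have s: "1 + \<omega> + \<omega>\<^sup>2 = 0"
    by (simp add: \<omega>_def complex_eq_iff)
  have "\<omega> ^ 3 - 1 = (\<omega> - 1) * (1 + \<omega> + \<omega>\<^sup>2)"
    by (simp add: algebra_simps power2_eq_square power3_eq_cube)
  with s have "\<omega> ^ 3 = 1" by simp
  with s show ?thesis using that by blast
qed

text \<open>
  Three consecutive powers of \<omega> add up to zero, so the symmetric sum of the 2s + 1 powers is
  periodic in s with period 3. In particular, it vanishes when 2s + 1 is a multiple of 3.
\<close>

lemma laurent_partial_sum_cube_root:
  assumes cube: "\<omega> ^ 3 = 1" and root: "1 + \<omega> + \<omega>\<^sup>2 = 0"
  shows "laurent_partial_sum \<omega> s = (if s mod 3 = 0 then 1 else if s mod 3 = 1 then 0 else -1)"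
proof -
  have \<omega>: "\<omega> \<noteq> 0" using cube by auto
  have inv: "inverse \<omega> = \<omega>\<^sup>2"
    using cube \<omega> by (simp add: field_simps power2_eq_square power3_eq_cube)
  have inv2: "inverse (\<omega>\<^sup>2) = \<omega>"
    using inv by (metis inverse_inverse_eq)
  have step: "laurent_partial_sum \<omega> (Suc s) = laurent_partial_sum \<omega> s + \<omega> ^ Suc s + inverse (\<omega> ^ Suc s)" for s
    unfolding laurent_partial_sum_def sum_int_interval_Suc power_int_minus power_int_of_nat ..
  have p: "\<omega> ^ (3 * m) = 1" for m
    by (simp add: power_mult cube)
  have sum: "\<omega> + \<omega>\<^sup>2 = -1"
    using root by (simp add: eq_neg_iff_add_eq_0 algebra_simps)
  have s1: "laurent_partial_sum \<omega> (3 * m + 1) = laurent_partial_sum \<omega> (3 * m) - 1" for m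
  proof -
    have "laurent_partial_sum \<omega> (3 * m + 1) = laurent_partial_sum \<omega> (3 * m) + (\<omega> + \<omega>\<^sup>2)"
      using step[of "3 * m"] by (simp add: p inv)
    then show ?thesis unfolding sum by simp
  qed
  have s2: "laurent_partial_sum \<omega> (3 * m + 2) = laurent_partial_sum \<omega> (3 * m) - 2" for m
  proof -
    have "laurent_partial_sum \<omega> (3 * m + 2) = laurent_partial_sum \<omega> (3 * m + 1) + (\<omega>\<^sup>2 + inverse (\<omega>\<^sup>2))"
      using step[of "3 * m + 1"] by (simp add: p power2_eq_square)
    also have "\<omega>\<^sup>2 + inverse (\<omega>\<^sup>2) = -1"
      unfolding inv2 using sum by (simp add: add.commute)
    finally show ?thesis unfolding s1 by simp
  qed
  have "laurent_partial_sum \<omega> (3 * m) = 1" for m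
  proof (induction m)
    case 0
    show ?case by (simp add: laurent_partial_sum_def)
  next
    case (Suc m)
    have "Suc (3 * m + 2) = 3 * Suc m" by simp
    then show ?case using step[of "3 * m + 2"] by (simp only: p s2 Suc.IH) simp
  qed
  with s1 s2 have v: "laurent_partial_sum \<omega> (3 * m) = 1" "laurent_partial_sum \<omega> (3 * m + 1) = 0"
    "laurent_partial_sum \<omega> (3 * m + 2) = -1" for m
    by simp_all
  have "\<exists>m. s = 3 * m \<or> s = 3 * m + 1 \<or> s = 3 * m + 2" by presburger
  then obtain m where "s = 3 * m \<or> s = 3 * m + 1 \<or> s = 3 * m + 2" by blast
  moreover have "(3 * m + 1) mod 3 = 1" "(3 * m + 2) mod 3 = 2" by presburger+
  ultimately show ?thesis
    by (elim disjE) (simp_all only: v, simp_all)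
qed

lemma qpoch_cube_factor:
  assumes cube: "\<omega> ^ 3 = 1" and root: "1 + \<omega> + \<omega>\<^sup>2 = 0"
  shows "qpoch (q ^ 3) (q ^ 6) n = qpoch (\<omega> * q) (q^2) n * qpoch (q / \<omega>) (q^2) n * qpoch q (q^2) n"
proof -
  have \<omega>: "\<omega> \<noteq> 0" using cube by auto
  have inv: "1 / \<omega> = \<omega>\<^sup>2"
    using cube \<omega> by (simp add: field_simps power2_eq_square power3_eq_cube)
  have "1 - u ^ 3 = (1 - \<omega> * u) * (1 - 1 / \<omega> * u) * (1 - u)" for u
  proof -
    have "(1 - \<omega> * u) * (1 - \<omega>\<^sup>2 * u) * (1 - u) =
        1 - (1 + \<omega> + \<omega>\<^sup>2) * u + (\<omega> + \<omega>\<^sup>2 + \<omega> ^ 3) * u\<^sup>2 - \<omega> ^ 3 * u ^ 3"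
      by (simp add: algebra_simps power2_eq_square power3_eq_cube)
    moreover have "\<omega> + \<omega>\<^sup>2 + \<omega> ^ 3 = 0" using cube root by (simp add: algebra_simps)
    ultimately show ?thesis unfolding inv root cube by simp
  qed
  from this[of "q * (q^2) ^ k" for k] have
    "1 - q ^ 3 * (q ^ 6) ^ k = (1 - \<omega> * q * (q^2) ^ k) * (1 - q / \<omega> * (q^2) ^ k) * (1 - q * (q^2) ^ k)" for k
    by (simp add: power_mult_distrib mult.assoc flip: power_mult)
  then show ?thesis
    unfolding qpoch_def by (simp add: prod.distrib)
qed

text \<open>
  The bilateral quintuple product series for p = q^9 and x = q, folded onto the naturals. The index
  M \<ge> 0 goes to s = 3M, and M = - m - 1 goes to s = 3m + 2. The two powers of q in each term of the
  bilateral series are the two powers of q that come from the factor 1 + q^(2s+1).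
\<close>

lemma quintuple_product_one_sided:
  fixes q :: complex
  assumes q: "norm q < 1" "q \<noteq> 0"
  defines "c \<equiv> \<lambda>s. if s mod 3 = 0 then 1 else if s mod 3 = 1 then 0 else (-1 :: complex)"
  shows "((\<lambda>s::nat. (q^2) ^ (s * s + s) * ((-1) ^ s * q ^ (s * s) * (1 + q ^ (2 * s + 1)) * c s))
           has_sum Q (q ^ 18) q) UNIV"
proof -
  define g where "g M = (-1) powi M * (q ^ 9) powi (3 * M * M + M) * (q powi (-3 * M) + q powi (3 * M + 1))" for M
  define h where "h s = (q^2) ^ (s * s + s) * ((-1) ^ s * q ^ (s * s) * (1 + q ^ (2 * s + 1)) * c s)" for s :: nat
  have g: "(g has_sum Q (q ^ 18) q) UNIV"
    using quintuple_product[of "q ^ 9" q] q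
    by (simp add: g_def[abs_def] norm_power power_less_one_iff flip: power_mult)
  have h: "h s = (-1) ^ s * c s * (q ^ (3 * s * s + 2 * s) + q ^ (3 * s * s + 4 * s + 1))" for s
  proof -
    have "q ^ (3 * s * s + 2 * s) = (q^2) ^ (s * s + s) * q ^ (s * s)"
      "q ^ (3 * s * s + 4 * s + 1) = (q^2) ^ (s * s + s) * q ^ (s * s) * q ^ (2 * s + 1)"
      unfolding power_mult[symmetric] power_add[symmetric]
      by (rule arg_cong[where f = "power q"], simp)+
    then show ?thesis by (simp only: h_def) (simp add: algebra_simps)
  qed
  have g': "g M = (-1) powi M * (q powi (9 * (3 * M * M + M) - 3 * M) + q powi (9 * (3 * M * M + M) + 3 * M + 1))" for M
    using q by (simp only: g_def power_int_power distrib_left mult.assoc power_int_add[OF disjI1, OF q(2), symmetric])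
       (simp add: algebra_simps)
  have nonneg: "h (3 * m) = g (int m)" for m
  proof -
    have "9 * (3 * int m * int m + int m) - 3 * int m = int (3 * (3 * m) * (3 * m) + 2 * (3 * m))"
      "9 * (3 * int m * int m + int m) + 3 * int m + 1 = int (3 * (3 * m) * (3 * m) + 4 * (3 * m) + 1)"
      by (simp_all add: algebra_simps)
    then have "g (int m) = (-1) ^ m * (q ^ (3 * (3 * m) * (3 * m) + 2 * (3 * m)) + q ^ (3 * (3 * m) * (3 * m) + 4 * (3 * m) + 1))"
      unfolding g' by (simp only: power_int_of_nat)
    moreover have "(-1) ^ (3 * m) = ((-1) ^ m :: complex)"
      by (simp add: power_mult)
    moreover have "c (3 * m) = 1" by (simp add: c_def)
    ultimately show ?thesis unfolding h by simp
  qed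
  have neg: "h (3 * m + 2) = g (- int m - 1)" for m
  proof -
    have "9 * (3 * (- int m - 1) * (- int m - 1) + (- int m - 1)) - 3 * (- int m - 1) =
        int (3 * (3 * m + 2) * (3 * m + 2) + 4 * (3 * m + 2) + 1)"
      "9 * (3 * (- int m - 1) * (- int m - 1) + (- int m - 1)) + 3 * (- int m - 1) + 1 =
        int (3 * (3 * m + 2) * (3 * m + 2) + 2 * (3 * m + 2))"
      by (simp_all add: algebra_simps)
    moreover have "(-1) powi (- int m - 1) = (- ((-1) ^ m) :: complex)"
    proof -
      have "- int m - 1 = - int (Suc m)" by simp
      then show ?thesis by (simp only: power_int_minus_one_minus power_int_of_nat) simp
    qed
    ultimately have "g (- int m - 1) = - ((-1) ^ m) * (q ^ (3 * (3 * m + 2) * (3 * m + 2) + 4 * (3 * m + 2) + 1)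
         + q ^ (3 * (3 * m + 2) * (3 * m + 2) + 2 * (3 * m + 2)))"
      unfolding g' by (simp only: power_int_of_nat)
    moreover have "(-1) ^ (3 * m + 2) = ((-1) ^ m :: complex)"
      by (simp add: power_mult power_add)
    moreover have "(3 * m + 2) mod 3 = 2" by presburger
    then have "c (3 * m + 2) = -1" by (simp add: c_def)
    ultimately show ?thesis unfolding h by (simp add: add.commute)
  qed
  have "(g has_sum Q (q ^ 18) q) UNIV = (h has_sum Q (q ^ 18) q) {s. s mod 3 \<noteq> 1}"
  proof (rule has_sum_reindex_bij_witness[
        where j = "\<lambda>M. if M \<ge> 0 then 3 * nat M else 3 * nat (- M - 1) + 2"
          and i = "\<lambda>s. if s mod 3 = 0 then int (s div 3) else - int (s div 3) - 1"])
    fix M :: int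
    have div: "(3 * m + 2) div 3 = m" "(3 * m + 2) mod 3 = 2" for m :: nat by presburger+
    consider m where "M = int m" | m where "M = - int m - 1"
    proof (cases "M \<ge> 0")
      case True
      then show ?thesis using that(1)[of "nat M"] by simp
    next
      case False
      then show ?thesis using that(2)[of "nat (- M - 1)"] by simp
    qed
    note M = this
    show "(if (if M \<ge> 0 then 3 * nat M else 3 * nat (- M - 1) + 2) mod 3 = 0
        then int ((if M \<ge> 0 then 3 * nat M else 3 * nat (- M - 1) + 2) div 3)
        else - int ((if M \<ge> 0 then 3 * nat M else 3 * nat (- M - 1) + 2) div 3) - 1) = M"
      by (rule M) (simp_all add: div del: add_2_eq_Suc')
    show "(if M \<ge> 0 then 3 * nat M else 3 * nat (- M - 1) + 2) \<in> {s. s mod 3 \<noteq> 1}"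
      by (rule M) (simp_all add: div del: add_2_eq_Suc')
    show "h (if M \<ge> 0 then 3 * nat M else 3 * nat (- M - 1) + 2) = g M"
      by (rule M) (simp_all add: nonneg neg del: add_2_eq_Suc')
  next
    fix s :: nat assume s: "s \<in> {s. s mod 3 \<noteq> 1}"
    show "(if (if s mod 3 = 0 then int (s div 3) else - int (s div 3) - 1) \<ge> 0
       then 3 * nat (if s mod 3 = 0 then int (s div 3) else - int (s div 3) - 1)
       else 3 * nat (- (if s mod 3 = 0 then int (s div 3) else - int (s div 3) - 1) - 1) + 2) = s"
    proof (cases "s mod 3 = 0")
      case False
      with s have "s mod 3 = 2" by simp
      then show ?thesis by simp presburger
    qed auto
  qed auto
  also have "(h has_sum Q (q ^ 18) q) {s. s mod 3 \<noteq> 1} = (h has_sum Q (q ^ 18) q) UNIV"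
    by (rule has_sum_cong_neutral) (auto simp: h_def c_def)
  finally show ?thesis using g by (simp add: h_def[abs_def])
qed

theorem theorem4p8:
  fixes q :: complex
  assumes "norm q < 1"
  shows "(\<lambda>j::nat. q ^ (2 * j * (j + 1)) * qpoch (q ^ 3) (q ^ 6) j
            / (qpoch (q ^ 2) (q ^ 2) (2 * j) * qpoch q (q ^ 2) (j + 1)))
         sums (Q (q ^ 18) q / qpoch_inf (q ^ 2) (q ^ 2))"
proof (cases "q = 0")
  case True
  have "(\<lambda>j::nat. q ^ (2 * j * (j + 1)) * qpoch (q ^ 3) (q ^ 6) j
            / (qpoch (q ^ 2) (q ^ 2) (2 * j) * qpoch q (q ^ 2) (j + 1))) = (\<lambda>j. if j = 0 then 1 else 0)"
    using True by (auto simp: qpoch_def)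
  moreover have "Q (q ^ 18) q / qpoch_inf (q ^ 2) (q ^ 2) = 1"
    using True by (simp add: Q_def qpochs_inf_def qpoch_inf_def)
  ultimately show ?thesis using sums_single[of 0 "\<lambda>_. 1 :: complex"] by simp
next
  case False
  have q2: "norm (q^2) < 1"
    using assms by (simp add: norm_power power_less_one_iff)
  obtain \<omega> :: complex where \<omega>: "\<omega> ^ 3 = 1" "1 + \<omega> + \<omega>\<^sup>2 = 0"
    using cube_root_of_unity by blast
  then have \<omega>0: "\<omega> \<noteq> 0" by auto
  define \<alpha> where "\<alpha> s = (-1) ^ s * q ^ (s * s) * (1 + q ^ (2 * s + 1)) * laurent_partial_sum \<omega> s" for s
  have "norm (\<alpha> s) \<le> 2" for s
  proof -
    have "norm (\<alpha> s) = norm q ^ (s * s) * norm (1 + q ^ (2 * s + 1)) * norm (laurent_partial_sum \<omega> s)"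
      by (simp only: \<alpha>_def norm_mult norm_power) simp
    also have "\<dots> \<le> 1 * 2 * 1"
    proof (intro mult_mono mult_nonneg_nonneg norm_ge_zero zero_le_power)
      show "norm q ^ (s * s) \<le> 1" using assms by (intro power_le_one) auto
      have "norm (1 + q ^ (2 * s + 1)) \<le> 1 + norm q ^ (2 * s + 1)"
        using norm_triangle_ineq[of 1 "q ^ (2 * s + 1)"] by (simp only: norm_one norm_power)
      moreover have "norm q ^ (2 * s + 1) \<le> 1" using assms by (intro power_le_one) auto
      ultimately show "norm (1 + q ^ (2 * s + 1)) \<le> 2" by linarith
      show "norm (laurent_partial_sum \<omega> s) \<le> 1"
        by (simp add: laurent_partial_sum_cube_root[OF \<omega>])
    qed auto
    finally show ?thesis by simp
  qed
  moreover have "((\<lambda>s. (q^2) ^ (s * s + s) * \<alpha> s) has_sum Q (q ^ 18) q) UNIV"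
    using quintuple_product_one_sided[OF assms False]
    by (simp only: \<alpha>_def laurent_partial_sum_cube_root[OF \<omega>])
  ultimately have "((\<lambda>n. (q^2) ^ (n * n + n) *
      (\<Sum>s\<le>n. \<alpha> s / (qpoch (q^2) (q^2) (n - s) * qpoch (q^2) (q^2) (n + s + 1))))
      has_sum Q (q ^ 18) q / qpoch_inf (q^2) (q^2)) UNIV"
    by (rule weak_bailey_lemma[OF q2])
  moreover have "(q^2) ^ (n * n + n) *
      (\<Sum>s\<le>n. \<alpha> s / (qpoch (q^2) (q^2) (n - s) * qpoch (q^2) (q^2) (n + s + 1))) =
      q ^ (2 * n * (n + 1)) * qpoch (q ^ 3) (q ^ 6) n
            / (qpoch (q ^ 2) (q ^ 2) (2 * n) * qpoch q (q ^ 2) (n + 1))" for n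
  proof -
    have "qpoch q (q^2) n \<noteq> 0"
    proof -
      have "1 - q * (q^2) ^ k \<noteq> 0" for k
        using one_minus_power_nonzero[OF assms, of "Suc (2 * k)"] by (simp add: power_mult)
      then show ?thesis by (simp add: qpoch_def)
    qed
    moreover have "qpoch q (q^2) (n + 1) = qpoch q (q^2) n * (1 - q ^ (2 * n + 1))"
      by (simp add: qpoch_Suc power_mult)
    ultimately have "(\<Sum>s\<le>n. \<alpha> s / (qpoch (q^2) (q^2) (n - s) * qpoch (q^2) (q^2) (n + s + 1))) =
        qpoch (q ^ 3) (q ^ 6) n / (qpoch (q ^ 2) (q ^ 2) (2 * n) * qpoch q (q ^ 2) (n + 1))"
      unfolding \<alpha>_def bailey_pair_two_parameter[OF assms False \<omega>0, symmetric] qpoch_cube_factor[OF \<omega>]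
      by (simp only:) simp
    moreover have "(q^2) ^ (n * n + n) = q ^ (2 * n * (n + 1))"
      unfolding power_mult[symmetric] by (rule arg_cong[where f = "power q"]) simp
    ultimately show ?thesis by simp
  qed
  ultimately show ?thesis
    by (intro has_sum_imp_sums) simp
qed

end
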